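(* Let $I$ be a fuzzy implication such that $f(y)=I(1,y)$ is strictly increasing on $[0,1]$, and let $A_I(x,y)=\inf\{z\in[0,1]\mid I(x,z)\geq y\}$ (which is an aggregation function). For nonempty sets $U,V$, fuzzy sets $D,D'$ on $U$ and $B$ on $V$, define the ACRI conclusion $$B'(y)=\sup_{x\in U}A_I\big(D'(x),I(D(x),B(y))\big),\quad y\in V.$$ Then for all nonempty $U,V$ and all fuzzy sets $D,D',D''$ on $U$ and $B$ on $V$ (writing $B''$ for the conclusion obtained from $D''$ in place of $D'$): (i) if $D'$ is normal, then $B(y)\leq B'(y)$ for all $y\in V$; (ii) if $D'\subseteq D''$, then $B'\subseteq B''$; (iii) if $D^C$ is normal and $D'=D^C$, then $B'(y)=1$ for all $y\in V$; (iv) if $D$ is normal and $D'=D$, then $B'=B$.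
   Context: A fuzzy implication is a function $I:[0,1]^2\to[0,1]$ non-increasing in the first variable, non-decreasing in the second, with $I(0,0)=I(1,1)=1$, $I(1,0)=0$. An aggregation function is $A:[0,1]^2\to[0,1]$ non-decreasing in each variable with $A(0,0)=0$, $A(1,1)=1$. A fuzzy set on $U$ is a map $U\to[0,1]$; $D\subseteq D'$ means $D(x)\leq D'(x)$ for all $x$; $D$ is normal if $D(x_0)=1$ for some $x_0$; $D^C(x)=1-D(x)$. *)

theory Defs
  imports Complex_Main
begin

text \<open>
  The unit interval is the subset \<open>{0..1}\<close> of \<^typ>\<open>real\<close>; operations on it are total real functions
  about which nothing is assumed outside \<open>{0..1}\<close>. Universes of discourse are carrier sets, and
  fuzzy sets on them are compared only on the carrier.
\<close>

definition fuzzy_implication :: "(real \<Rightarrow> real \<Rightarrow> real) \<Rightarrow> bool" where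
  "fuzzy_implication I \<longleftrightarrow>
     (\<forall>x\<in>{0..1}. \<forall>y\<in>{0..1}. I x y \<in> {0..1}) \<and>
     (\<forall>y\<in>{0..1}. antimono_on {0..1} (\<lambda>x. I x y)) \<and>
     (\<forall>x\<in>{0..1}. mono_on {0..1} (\<lambda>y. I x y)) \<and>
     I 0 0 = 1 \<and> I 1 1 = 1 \<and> I 1 0 = 0"

definition aggregation_function :: "(real \<Rightarrow> real \<Rightarrow> real) \<Rightarrow> bool" where
  "aggregation_function A \<longleftrightarrow>
     (\<forall>x\<in>{0..1}. \<forall>y\<in>{0..1}. A x y \<in> {0..1}) \<and>
     (\<forall>y\<in>{0..1}. mono_on {0..1} (\<lambda>x. A x y)) \<and>
     (\<forall>x\<in>{0..1}. mono_on {0..1} (\<lambda>y. A x y)) \<and>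
     A 0 0 = 0 \<and> A 1 1 = 1"

definition fuzzy_set :: "'a set \<Rightarrow> ('a \<Rightarrow> real) \<Rightarrow> bool" where
  "fuzzy_set U D \<longleftrightarrow> (\<forall>x\<in>U. D x \<in> {0..1})"

definition fuzzy_subset :: "'a set \<Rightarrow> ('a \<Rightarrow> real) \<Rightarrow> ('a \<Rightarrow> real) \<Rightarrow> bool" where
  "fuzzy_subset U D D' \<longleftrightarrow> (\<forall>x\<in>U. D x \<le> D' x)"

definition fuzzy_eq :: "'a set \<Rightarrow> ('a \<Rightarrow> real) \<Rightarrow> ('a \<Rightarrow> real) \<Rightarrow> bool" where
  "fuzzy_eq U D D' \<longleftrightarrow> (\<forall>x\<in>U. D x = D' x)"

definition fuzzy_normal :: "'a set \<Rightarrow> ('a \<Rightarrow> real) \<Rightarrow> bool" where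
  "fuzzy_normal U D \<longleftrightarrow> (\<exists>x\<in>U. D x = 1)"

definition fuzzy_compl :: "('a \<Rightarrow> real) \<Rightarrow> 'a \<Rightarrow> real" where
  "fuzzy_compl D x = 1 - D x"

definition agg_of_impl :: "(real \<Rightarrow> real \<Rightarrow> real) \<Rightarrow> real \<Rightarrow> real \<Rightarrow> real" where
  "agg_of_impl I x y = Inf {z \<in> {0..1}. y \<le> I x z}"

definition acri_conclusion ::
  "(real \<Rightarrow> real \<Rightarrow> real) \<Rightarrow> 'u set \<Rightarrow> ('u \<Rightarrow> real) \<Rightarrow> ('v \<Rightarrow> real) \<Rightarrow> ('u \<Rightarrow> real) \<Rightarrow> 'v \<Rightarrow> real" where
  "acri_conclusion I U D B D' y = (SUP x\<in>U. agg_of_impl I (D' x) (I (D x) (B y)))"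

text \<open>
  \<^const>\<open>Inf\<close> and \<^const>\<open>Sup\<close> on \<^typ>\<open>real\<close> are only meaningful on nonempty bounded sets. The
  following facts show that this is the case for the two definitions above.
\<close>

lemma agg_of_impl_set:
  assumes "fuzzy_implication I" "x \<in> {0..1}" "y \<in> {0..1}"
  shows "1 \<in> {z \<in> {0..1}. y \<le> I x z}" "bdd_below {z \<in> {0..1}. y \<le> I x z}"
proof -
  have "antimono_on {0..1} (\<lambda>x. I x 1)"
    using assms(1) unfolding fuzzy_implication_def by simp
  from monotone_onD[OF this, of x 1] have "I 1 1 \<le> I x 1"
    using assms(2) by simp
  moreover have "I 1 1 = 1"
    using assms unfolding fuzzy_implication_def by blast
  ultimately show "1 \<in> {z \<in> {0..1}. y \<le> I x z}"
    using assms by auto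
  show "bdd_below {z \<in> {0..1}. y \<le> I x z}"
    by (rule bdd_belowI[of _ 0]) auto
qed

lemma agg_of_impl_unit:
  assumes "fuzzy_implication I" "x \<in> {0..1}" "y \<in> {0..1}"
  shows "agg_of_impl I x y \<in> {0..1}"
proof -
  have "0 \<le> agg_of_impl I x y"
    unfolding agg_of_impl_def using agg_of_impl_set(1)[OF assms]
    by (intro cInf_greatest) auto
  moreover have "agg_of_impl I x y \<le> 1"
    unfolding agg_of_impl_def using agg_of_impl_set[OF assms] by (rule cInf_lower)
  ultimately show ?thesis by simp
qed

lemma aggregation_function_agg_of_impl:
  assumes I: "fuzzy_implication I" and f: "strict_mono_on {0..1} (\<lambda>y. I 1 y)"
  shows "aggregation_function (agg_of_impl I)"
  unfolding aggregation_function_def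
proof (intro conjI ballI)
  fix x y :: real
  assume "x \<in> {0..1}" "y \<in> {0..1}"
  then show "agg_of_impl I x y \<in> {0..1}"
    by (rule agg_of_impl_unit[OF I])
next
  fix y :: real
  assume y: "y \<in> {0..1}"
  show "mono_on {0..1} (\<lambda>x. agg_of_impl I x y)"
  proof (rule mono_onI)
    fix r s :: real
    assume rs: "r \<in> {0..1}" "s \<in> {0..1}" "r \<le> s"
    have "I s z \<le> I r z" if "z \<in> {0..1}" for z
      using I rs that unfolding fuzzy_implication_def monotone_on_def by blast
    then show "agg_of_impl I r y \<le> agg_of_impl I s y"
      unfolding agg_of_impl_def
      using agg_of_impl_set[OF I rs(1) y] agg_of_impl_set[OF I rs(2) y]
      by (intro cInf_superset_mono) force+
  qed
next
  fix x :: real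
  assume x: "x \<in> {0..1}"
  show "mono_on {0..1} (\<lambda>y. agg_of_impl I x y)"
  proof (rule mono_onI)
    fix r s :: real
    assume rs: "r \<in> {0..1}" "s \<in> {0..1}" "r \<le> s"
    show "agg_of_impl I x r \<le> agg_of_impl I x s"
      unfolding agg_of_impl_def
      using agg_of_impl_set[OF I x rs(1)] agg_of_impl_set[OF I x rs(2)] rs(3)
      by (intro cInf_superset_mono) force+
  qed
next
  have "{z \<in> {0..1}. 0 \<le> I 0 z} = {0..1}"
    using I unfolding fuzzy_implication_def by force
  then show "agg_of_impl I 0 0 = 0"
    unfolding agg_of_impl_def by simp
next
  have I1: "I 1 1 = 1"
    using I unfolding fuzzy_implication_def by blast
  have "z = 1" if "z \<in> {0..1}" "1 \<le> I 1 z" for z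
    using strict_mono_onD[OF f, of z 1] that I1 by force
  then have "{z \<in> {0..1}. 1 \<le> I 1 z} = {1}"
    using I1 by auto
  then show "agg_of_impl I 1 1 = 1"
    unfolding agg_of_impl_def by simp
qed

lemma acri_conclusion_bdd_above:
  assumes "fuzzy_implication I" "fuzzy_set U D" "fuzzy_set U D'" "fuzzy_set V B" "y \<in> V"
  shows "bdd_above ((\<lambda>x. agg_of_impl I (D' x) (I (D x) (B y))) ` U)"
proof (rule bdd_aboveI2)
  fix x
  assume "x \<in> U"
  then have "I (D x) (B y) \<in> {0..1}" "D' x \<in> {0..1}"
    using assms unfolding fuzzy_implication_def fuzzy_set_def by blast+
  then show "agg_of_impl I (D' x) (I (D x) (B y)) \<le> 1"
    using agg_of_impl_unit[OF assms(1)] by auto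
qed

end

theory Submission
  imports Defs
begin

text \<open>
  Everything rests on two bounds for \<open>A\<^sub>I\<close>: the point \<open>y\<close> itself competes in the infimum, so
  \<open>A\<^sub>I(x, I(x, y)) \<le> y\<close>; and since \<open>I(1, y) \<le> I(x, y)\<close>, strict monotonicity of \<open>I(1, \<cdot>)\<close> excludes
  every \<open>z < y\<close> from the infimum defining \<open>A\<^sub>I(1, I(x, y))\<close>, so that \<open>y \<le> A\<^sub>I(1, I(x, y))\<close>.
\<close>

lemma fuzzy_implication_unit:
  assumes "fuzzy_implication I" "x \<in> {0..1}" "y \<in> {0..1}"
  shows "I x y \<in> {0..1}"
  using assms unfolding fuzzy_implication_def by blast

lemma fuzzy_implication_antimono:
  assumes "fuzzy_implication I" "x \<in> {0..1}" "x' \<in> {0..1}" "y \<in> {0..1}" "x \<le> x'"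
  shows "I x' y \<le> I x y"
  using assms unfolding fuzzy_implication_def monotone_on_def by blast

text \<open>The corner value \<open>I 0 0 = 1\<close> is already the top, and \<open>I 0\<close> can
  only grow from there. This turns a point with \<open>D x = 0\<close> into the term
  \<open>A_I(1, 1)\<close>.\<close>

lemma fuzzy_implication_zero_left:
  assumes I: "fuzzy_implication I" and y: "y \<in> {0..1}"
  shows "I 0 y = 1"
proof -
  have "mono_on {0..1} (I 0)" "I 0 0 = 1"
    using I unfolding fuzzy_implication_def by auto
  then have "1 \<le> I 0 y"
    using y mono_onD[of "{0..1}" "I 0" 0 y] by simp
  then show ?thesis
    using fuzzy_implication_unit[OF I _ y, of 0] by simp
qed

lemma agg_of_impl_le:
  assumes "y \<in> {0..1}"
  shows "agg_of_impl I x (I x y) \<le> y"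
  unfolding agg_of_impl_def
  using assms by (intro cInf_lower bdd_belowI[of _ 0]) auto

lemma le_agg_of_impl_one:
  assumes I: "fuzzy_implication I" and f: "strict_mono_on {0..1} (\<lambda>y. I 1 y)"
    and x: "x \<in> {0..1}" and y: "y \<in> {0..1}"
  shows "y \<le> agg_of_impl I 1 (I x y)"
  unfolding agg_of_impl_def
proof (rule cInf_greatest)
  \<comment> \<open>The point 1 always competes in the infimum; without such a member
    \<open>Inf\<close> on the reals would carry no information.\<close>
  show "{z \<in> {0..1}. I x y \<le> I 1 z} \<noteq> {}"
    using agg_of_impl_set(1)[OF I _ fuzzy_implication_unit[OF I x y], of 1] by auto
next
  fix z
  assume z: "z \<in> {z \<in> {0..1}. I x y \<le> I 1 z}"
  have "I 1 y \<le> I x y"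
    using fuzzy_implication_antimono[OF I x _ y, of 1] x by simp
  also have "\<dots> \<le> I 1 z"
    using z by simp
  finally show "y \<le> z"
    using strict_mono_on_leD[OF f, of z y] strict_mono_onD[OF f, of z y] y z by force
qed

text \<open>Lower bounds on the conclusion come from one well-chosen point \<open>x\<close>; the
  real supremum dominates its terms because they are all bounded by 1.\<close>

lemma agg_of_impl_le_acri_conclusion:
  assumes "fuzzy_implication I" "fuzzy_set U D" "fuzzy_set U D'" "fuzzy_set V B" "y \<in> V" "x \<in> U"
  shows "agg_of_impl I (D' x) (I (D x) (B y)) \<le> acri_conclusion I U D B D' y"
  unfolding acri_conclusion_def
  using assms by (intro cSUP_upper acri_conclusion_bdd_above)

theorem theorem4p2:
  fixes I :: "real \<Rightarrow> real \<Rightarrow> real"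
    and U :: "'u set" and V :: "'v set"
    and D D' D'' :: "'u \<Rightarrow> real" and B :: "'v \<Rightarrow> real"
  assumes "fuzzy_implication I"
    and "strict_mono_on {0..1} (\<lambda>y. I 1 y)"
    and "U \<noteq> {}" and "V \<noteq> {}"
    and "fuzzy_set U D" and "fuzzy_set U D'" and "fuzzy_set U D''"
    and "fuzzy_set V B"
  shows "(fuzzy_normal U D' \<longrightarrow> (\<forall>y\<in>V. B y \<le> acri_conclusion I U D B D' y)) \<and>
         (fuzzy_subset U D' D'' \<longrightarrow>
            fuzzy_subset V (acri_conclusion I U D B D') (acri_conclusion I U D B D'')) \<and>
         (fuzzy_normal U (fuzzy_compl D) \<and> fuzzy_eq U D' (fuzzy_compl D) \<longrightarrow>
            (\<forall>y\<in>V. acri_conclusion I U D B D' y = 1)) \<and>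
         (fuzzy_normal U D \<and> fuzzy_eq U D' D \<longrightarrow>
            fuzzy_eq V (acri_conclusion I U D B D') B)"
proof (intro conjI impI ballI)
  note I = assms(1) and f = assms(2) and D = assms(5) and D' = assms(6) and D'' = assms(7)
    and B = assms(8)
  have unit: "D x \<in> {0..1}" "D' x \<in> {0..1}" "D'' x \<in> {0..1}" if "x \<in> U" for x
    using that D D' D'' unfolding fuzzy_set_def by auto
  have B_unit: "B y \<in> {0..1}" if "y \<in> V" for y
    using that B unfolding fuzzy_set_def by auto
  note I_unit = fuzzy_implication_unit[OF I unit(1) B_unit]
  note upper = agg_of_impl_le_acri_conclusion[OF I D D' B]

  \<comment> \<open>Where \<open>D' x = 1\<close>, the term is \<open>A_I(1, I(D x, B y))\<close>,
    which is at least \<open>B y\<close>. The name \<open>ge\<close> lets the last claim reuse this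
    bound.\<close>
  show ge: "B y \<le> acri_conclusion I U D B D' y" if "fuzzy_normal U D'" "y \<in> V" for y
  proof -
    obtain x where x: "x \<in> U" "D' x = 1"
      using \<open>fuzzy_normal U D'\<close> unfolding fuzzy_normal_def by blast
    then show ?thesis
      using le_agg_of_impl_one[OF I f unit(1)[OF x(1)] B_unit] upper[of y x] \<open>y \<in> V\<close>
      by fastforce
  qed

  show "fuzzy_subset V (acri_conclusion I U D B D') (acri_conclusion I U D B D'')"
    if sub: "fuzzy_subset U D' D''"
    unfolding fuzzy_subset_def
  proof
    fix y
    assume y: "y \<in> V"
    show "acri_conclusion I U D B D' y \<le> acri_conclusion I U D B D'' y"
      unfolding acri_conclusion_def
    \<comment> \<open>The suprema are compared term by term at the same \<open>x\<close>, since
      \<open>A_I\<close> is non-decreasing in its first argument.\<close>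
    proof (rule cSUP_mono[OF \<open>U \<noteq> {}\<close> acri_conclusion_bdd_above[OF I D D'' B y]])
      fix x
      assume x: "x \<in> U"
      have "mono_on {0..1} (\<lambda>t. agg_of_impl I t (I (D x) (B y)))"
        using aggregation_function_agg_of_impl[OF I f] I_unit[OF x y]
        unfolding aggregation_function_def by blast
      then have "agg_of_impl I (D' x) (I (D x) (B y)) \<le> agg_of_impl I (D'' x) (I (D x) (B y))"
        using unit[OF x] sub x unfolding fuzzy_subset_def by (auto dest: mono_onD)
      then show "\<exists>x'\<in>U. agg_of_impl I (D' x) (I (D x) (B y))
          \<le> agg_of_impl I (D'' x') (I (D x') (B y))"
        using x by blast
    qed
  qed

  show "acri_conclusion I U D B D' y = 1"
    if compl: "fuzzy_normal U (fuzzy_compl D) \<and> fuzzy_eq U D' (fuzzy_compl D)" and y: "y \<in> V" for y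
  proof (rule antisym)
    show "acri_conclusion I U D B D' y \<le> 1"
      unfolding acri_conclusion_def
    proof (rule cSUP_least[OF \<open>U \<noteq> {}\<close>])
      fix x
      assume "x \<in> U"
      then show "agg_of_impl I (D' x) (I (D x) (B y)) \<le> 1"
        using agg_of_impl_unit[OF I unit(2) I_unit] y by simp
    qed
    \<comment> \<open>A point where the complement equals 1 has \<open>D x = 0\<close>, so its term
      is \<open>A_I(1, I(0, B y)) = A_I(1, 1) = 1\<close> and the supremum reaches its upper
      bound.\<close>
    obtain x where x: "x \<in> U" "D x = 0" "D' x = 1"
      using compl unfolding fuzzy_normal_def fuzzy_eq_def fuzzy_compl_def by auto
    have "agg_of_impl I 1 1 = 1"
      using aggregation_function_agg_of_impl[OF I f] unfolding aggregation_function_def by blast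
    then show "1 \<le> acri_conclusion I U D B D' y"
      using upper[OF y x(1)] x fuzzy_implication_zero_left[OF I B_unit[OF y]] by simp
  qed

  show "fuzzy_eq V (acri_conclusion I U D B D') B"
    if "fuzzy_normal U D \<and> fuzzy_eq U D' D"
    unfolding fuzzy_eq_def
  proof (intro ballI antisym)
    fix y
    assume y: "y \<in> V"
    have eq: "D' x = D x" if "x \<in> U" for x
      using \<open>fuzzy_normal U D \<and> fuzzy_eq U D' D\<close> that unfolding fuzzy_eq_def by blast
    \<comment> \<open>With \<open>D'\<close> replaced by \<open>D\<close>, every term has the form
      \<open>A_I(x, I(x, y))\<close>, for which \<open>B y\<close> itself competes in the
      infimum.\<close>
    show "acri_conclusion I U D B D' y \<le> B y"
      unfolding acri_conclusion_def
      using \<open>U \<noteq> {}\<close> by (rule cSUP_least) (simp only: eq agg_of_impl_le[OF B_unit[OF y]])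
    \<comment> \<open>Normality passes from \<open>D\<close> to \<open>D'\<close>, so the reverse
      inequality is the first claim.\<close>
    have "fuzzy_normal U D'"
      using that eq unfolding fuzzy_normal_def by auto
    then show "B y \<le> acri_conclusion I U D B D' y"
      using y by (rule ge)
  qed
qed

end
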